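(* Let $\rho_0\in\mathcal{P}_2(\mathbb{R})$, let $v_0:\mathbb{R}\to\mathbb{R}$ be absolutely continuous, and let $X:[0,\infty)\to L^2(\rho_0)$ be a sticky particles flow map for $(\rho_0,v_0)$ as defined in the context. Suppose there is a real number $R$ such that $$|X(t,y)|\le R\quad\text{for all }y\in\mathrm{spt}(\rho_0)\text{ and }t\ge0.$$ Then the limit $\lim_{t\to\infty}X(t,\cdot)$ exists in $L^2(\rho_0)$.
   Context: $\mathcal{P}_2(\mathbb{R})$ is the set of Borel probability measures on $\mathbb{R}$ with finite second moment. For Borel $Z:\mathbb{R}\to\mathbb{R}$, the conditional expectation $\mathbb{E}_{\rho_0}[v_0|Z]$ is $f\circ Z$, where $f\in L^2(Z_{\#}\rho_0)$ is the unique element with $\int f(Z(y))\zeta(Z(y))\,\rho_0(dy)=\int v_0(y)\zeta(Z(y))\,\rho_0(dy)$ for all $\zeta\in L^2(Z_{\#}\rho_0)$ ($Z_{\#}\rho_0$ is the push-forward). A sticky particles flow map for $(\rho_0,v_0)$ is a Lipschitz continuous $X:[0,\infty)\to L^2(\rho_0)$ such that: (i) $\dot X(t,\cdot)=\mathbb{E}_{\rho_0}[v_0|X(t,\cdot)]$ for a.e. $t\ge0$ and $X(0,\cdot)=\mathrm{id}_{\mathbb{R}}$; (ii) for each $t\ge0$, $y\mapsto X(t,y)$ is nondecreasing on $\mathrm{spt}(\rho_0)$; (iii) for each $0<s\le t$ there is a Lipschitz function $f_{t,s}:\mathbb{R}\to\mathbb{R}$ with $X(t,\cdot)=f_{t,s}(X(s,\cdot))$.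 (Such an $X$ is known to exist.) *)

theory Defs
  imports "HOL-Probability.Probability"
begin

definition P2 :: "real measure set" where
  "P2 = {\<rho>. prob_space \<rho> \<and> sets \<rho> = sets borel \<and> integrable \<rho> (\<lambda>y. y\<^sup>2)}"

definition spt :: "real measure \<Rightarrow> real set" where
  "spt \<rho> = {y. \<forall>U. open U \<and> y \<in> U \<longrightarrow> emeasure \<rho> U > 0}"

text \<open>
  Elements of \<open>L\<^sup>2(\<rho>)\<close> are represented by functions. Equality in \<open>L\<^sup>2(\<rho>)\<close> is equality
  \<open>\<rho>\<close>-almost everywhere, and distances are the seminorm \<open>L2_norm \<rho>\<close> of differences.
\<close>

definition L2 :: "real measure \<Rightarrow> (real \<Rightarrow> real) set" where
  "L2 \<rho> = {f. f \<in> borel_measurable \<rho> \<and> integrable \<rho> (\<lambda>y. (f y)\<^sup>2)}"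

definition L2_norm :: "real measure \<Rightarrow> (real \<Rightarrow> real) \<Rightarrow> real" where
  "L2_norm \<rho> f = sqrt (\<integral>y. (f y)\<^sup>2 \<partial>\<rho>)"

text \<open>
  Absolute continuity on the whole line: one \<open>\<delta>\<close> for all finite families of disjoint intervals
  in \<open>\<real>\<close>, not merely on each compact interval.
\<close>

definition abs_continuous :: "(real \<Rightarrow> real) \<Rightarrow> bool" where
  "abs_continuous v \<longleftrightarrow>
     (\<forall>\<epsilon>>0. \<exists>\<delta>>0. \<forall>(n::nat) (a::nat \<Rightarrow> real) (b::nat \<Rightarrow> real).
        (\<forall>i<n. a i \<le> b i) \<and>
        disjoint_family_on (\<lambda>i. {a i<..<b i}) {..<n} \<and>
        (\<Sum>i<n. b i - a i) < \<delta> \<longrightarrow>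
        (\<Sum>i<n. \<bar>v (b i) - v (a i)\<bar>) < \<epsilon>)"

text \<open>
  \<open>is_cond_exp \<rho> v Z g\<close> says that \<open>g\<close> is a version of the conditional expectation of \<open>v\<close>
  given \<open>Z\<close> under \<open>\<rho>\<close>.
\<close>

definition is_cond_exp ::
    "real measure \<Rightarrow> (real \<Rightarrow> real) \<Rightarrow> (real \<Rightarrow> real) \<Rightarrow> (real \<Rightarrow> real) \<Rightarrow> bool" where
  "is_cond_exp \<rho> v Z g \<longleftrightarrow>
     g \<in> borel_measurable \<rho> \<and>
     (\<exists>f \<in> L2 (distr \<rho> borel Z).
        (\<forall>\<zeta> \<in> L2 (distr \<rho> borel Z).
           (\<integral>y. f (Z y) * \<zeta> (Z y) \<partial>\<rho>) = (\<integral>y. v y * \<zeta> (Z y) \<partial>\<rho>)) \<and>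
        (AE y in \<rho>. g y = f (Z y)))"

lemma is_cond_exp_real_cond_exp:
  assumes "prob_space \<rho>" "sets \<rho> = sets borel" "v \<in> L2 \<rho>" "Z \<in> borel_measurable \<rho>"
    and "is_cond_exp \<rho> v Z g"
  shows "AE y in \<rho>. g y = real_cond_exp \<rho> (vimage_algebra (space \<rho>) Z borel) v y"
proof -
  interpret prob_space \<rho> by fact
  note [measurable] = assms(4)
  let ?F = "vimage_algebra (space \<rho>) Z borel"
  have sub: "subalgebra \<rho> ?F"
    unfolding subalgebra_def using assms(4) by (auto simp: sets_vimage_algebra2)
  interpret sigma_finite_subalgebra \<rho> ?F
    by (intro finite_measure_subalgebra_is_sigma_finite finite_measure_subalgebra.intro
        finite_measure_subalgebra_axioms.intro sub finite_measure_axioms)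
  obtain f where f: "f \<in> L2 (distr \<rho> borel Z)"
    and eq: "\<And>\<zeta>. \<zeta> \<in> L2 (distr \<rho> borel Z) \<Longrightarrow>
        (\<integral>y. f (Z y) * \<zeta> (Z y) \<partial>\<rho>) = (\<integral>y. v y * \<zeta> (Z y) \<partial>\<rho>)"
    and ae: "AE y in \<rho>. g y = f (Z y)"
    using assms(5) unfolding is_cond_exp_def by blast
  have [measurable]: "f \<in> borel_measurable borel" using f by (simp add: L2_def)
  have "AE y in \<rho>. real_cond_exp \<rho> ?F v y = f (Z y)"
  proof (rule real_cond_exp_charact)
    fix A assume "A \<in> sets ?F"
    then obtain B where [measurable]: "B \<in> sets borel" and A: "A = Z -` B \<inter> space \<rho>"
      by (auto simp: sets_vimage_algebra2)
    have sq: "(\<lambda>z. (indicator B z :: real)\<^sup>2) = indicator B"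
      by (auto simp: indicator_def)
    have "indicator B \<in> L2 (distr \<rho> borel Z)"
      by (auto simp: L2_def sq integrable_distr_eq intro!: integrable_const_bound[where B=1])
    from eq[OF this] show "(\<integral>x\<in>A. v x \<partial>\<rho>) = (\<integral>x\<in>A. f (Z x) \<partial>\<rho>)"
      unfolding set_lebesgue_integral_def A
      by (auto simp: indicator_def mult.commute cong: Bochner_Integration.integral_cong)
  next
    show "integrable \<rho> v"
      using assms(3) by (auto simp: L2_def intro: square_integrable_imp_integrable)
    have "integrable \<rho> (\<lambda>y. (f (Z y))\<^sup>2)"
      using f by (auto simp: L2_def integrable_distr_eq)
    then show "integrable \<rho> (\<lambda>y. f (Z y))"
      by (rule square_integrable_imp_integrable[rotated]) measurable
    have "Z \<in> measurable ?F borel"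
      by (rule measurable_vimage_algebra1) simp
    then show "(\<lambda>y. f (Z y)) \<in> borel_measurable ?F"
      by (rule measurable_compose) measurable
  qed
  with ae show ?thesis by eventually_elim simp
qed

text \<open>
  Only the values \<open>X t\<close> with \<open>t \<ge> 0\<close> matter. The time derivative is the limit of difference
  quotients in \<open>L\<^sup>2(\<rho>)\<close>.
\<close>

definition sticky_particles_flow_map ::
    "real measure \<Rightarrow> (real \<Rightarrow> real) \<Rightarrow> (real \<Rightarrow> real \<Rightarrow> real) \<Rightarrow> bool" where
  "sticky_particles_flow_map \<rho> v X \<longleftrightarrow>
     (\<forall>t\<ge>0. X t \<in> L2 \<rho>) \<and>
     (\<exists>C\<ge>0. \<forall>s\<ge>0. \<forall>t\<ge>0. L2_norm \<rho> (\<lambda>y. X t y - X s y) \<le> C * \<bar>t - s\<bar>) \<and>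
     (AE t in lborel. t \<ge> 0 \<longrightarrow>
        (\<exists>g. is_cond_exp \<rho> v (X t) g \<and>
             ((\<lambda>s. L2_norm \<rho> (\<lambda>y. (X s y - X t y) / (s - t) - g y)) \<longlongrightarrow> 0)
               (at t within {0..}))) \<and>
     (AE y in \<rho>. X 0 y = y) \<and>
     (\<forall>t\<ge>0. mono_on (spt \<rho>) (X t)) \<and>
     (\<forall>s t. 0 < s \<and> s \<le> t \<longrightarrow>
        (\<exists>f C. C-lipschitz_on UNIV f \<and> (AE y in \<rho>. X t y = f (X s y))))"

end

theory Submission
  imports Defs
begin

text \<open>
  Write \<open>mom L t\<close> for the integral of \<open>X t\<close> over a set \<open>L\<close>. The sets \<open>L\<close> that matter are the
  initial segments of the support (\<open>lower L\<close>), because they are the sublevel sets of monotone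
  functions. For them \<open>mom L t\<close> is nondecreasing in \<open>t\<close>, and the total \<open>mom UNIV t\<close> is constant.
  This says that mass drifts inwards, towards the middle of the distribution; in mass
  coordinates, the primitive of \<open>X t\<close> is the convex envelope of the primitive of \<open>id + t v\<^sub>0\<close>,
  and this envelope increases with \<open>t\<close> when the motion is bounded.

  Monotonicity comes out as follows. If a set \<open>A\<close> is a union of level sets of \<open>X t\<close>, then it is
  also a union of level sets of \<open>X s\<close> for every earlier \<open>s > 0\<close>, so the conditional expectation preserves
  the momentum of \<open>A\<close> up to time \<open>t\<close> and \<open>mom A\<close> is affine on \<open>[0, t]\<close>
  (\<open>mom_vimage_affine\<close>). A general initial segment \<open>L\<close> cuts at most one level set \<open>P\<close> of \<open>X t\<close>.
  On \<open>P\<close> the map \<open>X t\<close> and the velocity are constant, while the piece \<open>L \<inter> P\<close> started to the left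
  of the rest of \<open>P\<close>; comparing centres of mass gives
  \<open>t * d/dt mom L t \<le> mom L t - mom L 0\<close> (\<open>velocity_le_chord\<close>), that is,
  \<open>(mom L t - mom L 0) / t\<close> is nonincreasing. Since \<open>X\<close> is bounded this quotient tends to \<open>0\<close>, so it
  is nonnegative (\<open>mom_lower_ge_initial\<close>). Hence the segments on which \<open>mom\<close> is affine have
  nonnegative momentum, and the momentum of \<open>L\<close> lies between the momenta of two of them
  (\<open>velocity_lower_nonneg\<close>).

  Convergence is then a Hilbert space argument. By a layer cake decomposition,
  \<open>X t - X s\<close> with \<open>s \<le> t\<close> has nonpositive inner product with every monotone map \<open>X u\<close>
  (\<open>increment_inner_nonpos\<close>). The case \<open>u = t\<close> gives
  \<open>\<parallel>X t - X s\<parallel>\<^sup>2 \<le> \<parallel>X s\<parallel>\<^sup>2 - \<parallel>X t\<parallel>\<^sup>2\<close>, so \<open>\<parallel>X t\<parallel>\<^sup>2\<close> decreases to a limit and \<open>X\<close> is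
  Cauchy.
\<close>

section \<open>Lipschitz functions with almost everywhere signed derivative\<close>

text \<open>
  The exceptional null set is covered by an open set \<open>U\<close> of measure less than \<open>e\<close>. Subtracting
  \<open>e * (t - a)\<close> and \<open>C\<close> times the measure of \<open>U \<inter> {a..t}\<close> from \<open>\<phi>\<close> costs only a multiple of \<open>e\<close>
  and makes the function locally nonincreasing to the right of every point: on \<open>U\<close> the second
  correction absorbs the Lipschitz growth, off \<open>U\<close> the derivative is at most \<open>0\<close>.
\<close>

lemma lipschitz_AE_deriv_nonpos_imp_le:
  fixes \<phi> :: "real \<Rightarrow> real"
  assumes ab: "a \<le> b" and lip: "C-lipschitz_on {a..b} \<phi>"
    and deriv: "AE t in lborel. t \<in> {a<..<b} \<longrightarrow> (\<exists>D\<le>0. (\<phi> has_real_derivative D) (at t))"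
  shows "\<phi> b \<le> \<phi> a"
proof -
  have C: "0 \<le> C" using lip by (rule lipschitz_on_nonneg)
  have lip': "\<bar>\<phi> s - \<phi> t\<bar> \<le> C * \<bar>s - t\<bar>" if "s \<in> {a..b}" "t \<in> {a..b}" for s t
    using lipschitz_onD[OF lip that] by (simp add: dist_real_def)
  obtain N where N: "N \<in> null_sets lborel"
    and N_deriv: "\<And>t. t \<in> {a<..<b} \<Longrightarrow> t \<notin> N \<Longrightarrow> \<exists>D\<le>0. (\<phi> has_real_derivative D) (at t)"
    using deriv by (auto elim!: AE_E3)
  have main: "\<phi> b \<le> \<phi> a + e * (b - a) + C * e" if e: "e > 0" for e
  proof -
    have aN: "insert a N \<in> null_sets lborel"
      using null_sets.Un[OF N, of "{a}"] finite_imp_null_set_lborel[of "{a}"] by simp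
    \<comment> \<open>The left endpoint is covered as well, since no derivative is available there.\<close>
    obtain U where U: "open U" "insert a N \<subseteq> U" "emeasure lborel (U - insert a N) < e"
      using outer_regular_lborel[of "insert a N" e] aN e by (auto simp: null_sets_def)
    have [measurable]: "U \<in> sets lborel" using U(1) by simp
    have "emeasure lborel U = emeasure lborel (U - insert a N)"
      using aN U(1) by (intro emeasure_Diff_null_set[symmetric]) auto
    then have measU: "emeasure lborel U < e" using U(3) by simp
    define m where "m t = measure lborel (U \<inter> {a..t})" for t
    have fin: "U \<inter> {x..y} \<in> fmeasurable lborel" for x y
      by (rule fmeasurableI2[of "{x..y}"])
        (use U(1) in \<open>auto intro: fmeasurable_compact\<close>)
    have fin2: "U \<inter> {x<..y} \<in> fmeasurable lborel" for x y
      by (rule fmeasurableI2[OF fin[of x y]]) (use U(1) in auto)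
    have m_add: "m t = m s + measure lborel (U \<inter> {s<..t})" if "a \<le> s" "s \<le> t" for s t
    proof -
      have "U \<inter> {a..t} = (U \<inter> {a..s}) \<union> (U \<inter> {s<..t})" using that by auto
      then show ?thesis unfolding m_def using fin[of a s] fin2[of s t]
        by (simp add: measure_Un_AE)
    qed
    have m_up: "m t \<le> m s + (t - s)" if "a \<le> s" "s \<le> t" for s t
    proof -
      have "measure lborel (U \<inter> {s<..t}) \<le> measure lborel {s<..t}"
        by (rule measure_mono_fmeasurable)
          (use U(1) in \<open>auto intro: fmeasurableI2[OF fmeasurable_compact[of "{s..t}"]]\<close>)
      then show ?thesis using m_add[OF that] that by simp
    qed
    have m_mono: "m s \<le> m t" if "a \<le> s" "s \<le> t" for s t
      using m_add[OF that] by simp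
    have m_b: "m b \<le> e"
    proof -
      have "emeasure lborel (U \<inter> {a..b}) \<le> emeasure lborel U"
        by (rule emeasure_mono) (use U(1) in auto)
      then have "emeasure lborel (U \<inter> {a..b}) \<le> ennreal e" using measU by simp
      then show ?thesis unfolding m_def measure_def using e by (simp add: enn2real_leI)
    qed
    define \<psi> where "\<psi> t = \<phi> t - e * (t - a) - C * m t" for t
    have right: "\<exists>d>0. \<forall>s\<in>{t<..<t+d}. s \<le> b \<longrightarrow> \<psi> s \<le> \<psi> t" if t: "a \<le> t" "t < b" for t
    proof (cases "t \<in> U")
      case True
      then obtain d where d: "d > 0" "\<And>y. \<bar>y - t\<bar> < d \<Longrightarrow> y \<in> U"
        using U(1) unfolding open_dist dist_real_def by metis
      have "\<psi> s \<le> \<psi> t" if s: "s \<in> {t<..<t+d}" "s \<le> b" for s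
      proof -
        have "U \<inter> {t<..s} = {t<..s}" using d s by auto
        then have m: "m s = m t + (s - t)" using m_add[of t s] s t by simp
        have "\<phi> s - \<phi> t \<le> C * (s - t)" using lip'[of s t] s t by auto
        moreover have "0 \<le> e * (s - t)" using s e by simp
        ultimately show ?thesis unfolding \<psi>_def m by (simp add: algebra_simps)
      qed
      then show ?thesis using d(1) by blast
    next
      case False
      then have "t \<noteq> a" "t \<notin> N" using U(2) by auto
      then obtain D where D: "D \<le> 0" "(\<phi> has_real_derivative D) (at t)"
        using N_deriv[of t] t by auto
      have "((\<lambda>s. (\<phi> s - \<phi> t) / (s - t)) \<longlongrightarrow> D) (at t)"
        using D(2) by (simp add: has_field_derivative_iff)
      then have "\<forall>\<^sub>F s in at t. (\<phi> s - \<phi> t) / (s - t) < e"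
        using D(1) e by (intro order_tendstoD(2)[of _ D]) auto
      then obtain d where d: "d > 0"
        "\<And>s. s \<noteq> t \<Longrightarrow> dist s t < d \<Longrightarrow> (\<phi> s - \<phi> t) / (s - t) < e"
        unfolding eventually_at by auto
      have "\<psi> s \<le> \<psi> t" if s: "s \<in> {t<..<t+d}" "s \<le> b" for s
      proof -
        have "(\<phi> s - \<phi> t) / (s - t) < e" using d(2)[of s] s by (auto simp: dist_real_def)
        then have "\<phi> s - \<phi> t \<le> e * (s - t)" using s by (simp add: divide_less_eq)
        moreover have "C * m t \<le> C * m s" using m_mono[of t s] s t C by (intro mult_left_mono) auto
        ultimately show ?thesis unfolding \<psi>_def by (simp add: algebra_simps)
      qed
      then show ?thesis using d(1) by blast
    qed
    have "\<bar>m s - m t\<bar> \<le> 1 * \<bar>s - t\<bar>" if "s \<in> {a..b}" "t \<in> {a..b}" for s t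
      using m_up[of s t] m_up[of t s] m_mono[of s t] m_mono[of t s] that by (auto simp: abs_if)
    then have "1-lipschitz_on {a..b} m"
      by (intro lipschitz_onI) (auto simp: dist_real_def)
    then have cont: "continuous_on {a..b} \<psi>"
      unfolding \<psi>_def
      using lipschitz_on_continuous_on[OF lip] lipschitz_on_continuous_on
      by (intro continuous_intros) auto
    \<comment> \<open>The last point at which \<open>\<psi>\<close> does not exceed \<open>\<psi> a\<close> must be \<open>b\<close>, as \<open>\<psi>\<close> does not
      increase immediately to the right of it.\<close>
    define S where "S = {t \<in> {a..b}. \<psi> t \<le> \<psi> a}"
    have "closed S" unfolding S_def using cont
      by (intro continuous_on_closed_Collect_le continuous_intros) auto
    moreover have "bounded S"
      by (rule bounded_subset[of "{a..b}"]) (auto simp: S_def)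
    ultimately have "compact S" by (simp add: compact_eq_bounded_closed)
    moreover have "a \<in> S" using ab by (simp add: S_def)
    ultimately obtain c where c: "c \<in> S" "\<And>x. x \<in> S \<Longrightarrow> x \<le> c"
      using compact_attains_sup[of S] by auto
    have "c = b"
    proof (rule ccontr)
      assume "c \<noteq> b"
      then have cb: "a \<le> c" "c < b" using c(1) by (auto simp: S_def)
      then obtain d where d: "d > 0" "\<forall>s\<in>{c<..<c+d}. s \<le> b \<longrightarrow> \<psi> s \<le> \<psi> c"
        using right by blast
      define s where "s = min b (c + d / 2)"
      have s: "c < s" "s < c + d" "s \<le> b" unfolding s_def using d(1) cb by auto
      then have "\<psi> s \<le> \<psi> a" using d(2) c(1) by (force simp: S_def)
      then have "s \<in> S" using s cb by (auto simp: S_def)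
      then show False using c(2)[of s] s by simp
    qed
    then have "\<psi> b \<le> \<psi> a" using c(1) by (simp add: S_def)
    moreover have "C * m b \<le> C * e" using m_b C by (rule mult_left_mono)
    moreover have "0 \<le> C * m a" unfolding m_def using C by simp
    ultimately show ?thesis unfolding \<psi>_def by (simp add: algebra_simps)
  qed
  have *: "\<phi> b \<le> \<phi> a + (b - a + C) * e" if "e > 0" for e
    using main[OF that] by (simp add: algebra_simps)
  show ?thesis
  proof (rule field_le_epsilon)
    fix e :: real assume e: "e > 0"
    have pos: "b - a + C + 1 > 0" using ab C by simp
    have "\<phi> b \<le> \<phi> a + (b - a + C) * (e / (b - a + C + 1))"
      using e pos by (intro *) simp
    also have "(b - a + C) * (e / (b - a + C + 1)) \<le> e"
      using e pos by (simp add: field_simps)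
    finally show "\<phi> b \<le> \<phi> a + e" by simp
  qed
qed

lemma lipschitz_AE_deriv_nonneg_imp_le:
  fixes \<phi> :: "real \<Rightarrow> real"
  assumes "a \<le> b" and lip: "C-lipschitz_on {a..b} \<phi>"
    and deriv: "AE t in lborel. t \<in> {a<..<b} \<longrightarrow> (\<exists>D\<ge>0. (\<phi> has_real_derivative D) (at t))"
  shows "\<phi> a \<le> \<phi> b"
proof -
  have "- \<phi> b \<le> - \<phi> a"
  proof (rule lipschitz_AE_deriv_nonpos_imp_le[OF assms(1)])
    show "C-lipschitz_on {a..b} (\<lambda>t. - \<phi> t)" using lip by simp
    show "AE t in lborel. t \<in> {a<..<b} \<longrightarrow> (\<exists>D\<le>0. ((\<lambda>t. - \<phi> t) has_real_derivative D) (at t))"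
      using deriv by eventually_elim (metis DERIV_minus neg_le_0_iff_le)
  qed
  then show ?thesis by simp
qed

lemma lipschitz_AE_deriv_const_imp_affine:
  fixes \<phi> :: "real \<Rightarrow> real"
  assumes "a \<le> b" and lip: "C-lipschitz_on {a..b} \<phi>"
    and deriv: "AE t in lborel. t \<in> {a<..<b} \<longrightarrow> (\<phi> has_real_derivative c) (at t)"
  shows "\<phi> b = \<phi> a + c * (b - a)"
proof -
  define \<psi> where "\<psi> t = \<phi> t - c * t" for t
  have lip\<psi>: "(C + \<bar>c\<bar> * 1)-lipschitz_on {a..b} \<psi>"
    unfolding \<psi>_def using lipschitz_on_cmult_real[OF lipschitz_on_id, of c]
    by (intro lipschitz_on_diff lip) (auto simp: id_def)
  have "AE t in lborel. t \<in> {a<..<b} \<longrightarrow> (\<psi> has_real_derivative 0) (at t)"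
    using deriv by eventually_elim (auto simp: \<psi>_def[abs_def] intro!: derivative_eq_intros)
  then have "\<psi> b \<le> \<psi> a" "\<psi> a \<le> \<psi> b"
    by (auto intro!: lipschitz_AE_deriv_nonpos_imp_le[OF assms(1) lip\<psi>]
        lipschitz_AE_deriv_nonneg_imp_le[OF assms(1) lip\<psi>] elim!: eventually_mono)
  then show ?thesis by (simp add: \<psi>_def algebra_simps)
qed

section \<open>Integration lemmas\<close>

text \<open>
  The complement of the support is a union of open null sets, and countably many of them suffice.
\<close>

lemma AE_mem_spt:
  assumes "sets \<rho> = sets borel"
  shows "AE y in \<rho>. y \<in> spt \<rho>"
proof -
  define \<F> where "\<F> = {U :: real set. open U \<and> emeasure \<rho> U = 0}"
  have eq: "- spt \<rho> = \<Union>\<F>"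
    unfolding spt_def \<F>_def by (auto simp: not_less)
  obtain \<G> where \<G>: "\<G> \<subseteq> \<F>" "countable \<G>" "\<Union>\<G> = \<Union>\<F>"
    using Lindelof[of \<F>] unfolding \<F>_def by blast
  have "U \<in> null_sets \<rho>" if "U \<in> \<G>" for U
    using that \<G>(1) assms by (auto simp: \<F>_def null_sets_def)
  then have "(\<Union>U\<in>\<G>. U) \<in> null_sets \<rho>"
    using \<G>(2) by (intro null_sets_UN') auto
  then have "- spt \<rho> \<in> null_sets \<rho>"
    using \<G>(3) eq by simp
  then show ?thesis
    by (rule AE_I') auto
qed

text \<open>
  This is the nonnegativity of the variance of \<open>\<bar>f\<bar>\<close>.
\<close>

lemma (in prob_space) integral_abs_le_sqrt:
  fixes f :: "'a \<Rightarrow> real"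
  assumes "f \<in> borel_measurable M" "integrable M (\<lambda>y. (f y)\<^sup>2)"
  shows "(\<integral>y. \<bar>f y\<bar> \<partial>M) \<le> sqrt (\<integral>y. (f y)\<^sup>2 \<partial>M)"
proof -
  have i: "integrable M (\<lambda>y. \<bar>f y\<bar>)"
    using square_integrable_imp_integrable[OF assms] by simp
  have "0 \<le> (\<integral>y. (\<bar>f y\<bar> - (\<integral>y. \<bar>f y\<bar> \<partial>M))\<^sup>2 \<partial>M)" by simp
  also have "\<dots> = (\<integral>y. (f y)\<^sup>2 \<partial>M) - (\<integral>y. \<bar>f y\<bar> \<partial>M)\<^sup>2"
    using variance_eq[OF i] assms(2) by simp
  finally show ?thesis
    by (intro real_le_rsqrt) simp
qed

lemma (in prob_space) abs_set_integral_le_sqrt: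
  fixes f :: "'a \<Rightarrow> real"
  assumes "A \<in> sets M" and f: "f \<in> borel_measurable M" "integrable M (\<lambda>y. (f y)\<^sup>2)"
  shows "\<bar>\<integral>y\<in>A. f y \<partial>M\<bar> \<le> sqrt (\<integral>y. (f y)\<^sup>2 \<partial>M)"
proof -
  have i: "integrable M f" using square_integrable_imp_integrable[OF f] .
  have "\<bar>\<integral>y\<in>A. f y \<partial>M\<bar> \<le> (\<integral>y. \<bar>indicator A y * f y\<bar> \<partial>M)"
    unfolding set_lebesgue_integral_def by (simp add: integral_abs_bound)
  also have "\<dots> \<le> (\<integral>y. \<bar>f y\<bar> \<partial>M)"
    using integrable_mult_indicator[OF assms(1) i] i
    by (intro integral_mono integrable_abs) (auto simp: abs_mult split: split_indicator)
  also have "\<dots> \<le> sqrt (\<integral>y. (f y)\<^sup>2 \<partial>M)" by (rule integral_abs_le_sqrt[OF f])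
  finally show ?thesis .
qed

text \<open>
  Layer cake: \<open>R - k y\<close> is the length of the set of levels \<open>l \<le> R\<close> with \<open>k y \<le> l\<close>, so by Fubini the
  integral of \<open>(R - k) * D\<close> is an integral over \<open>l\<close> of the integrals of \<open>D\<close> over sublevel sets of \<open>k\<close>.
\<close>

lemma (in finite_measure) integral_mult_nonpos_if_sublevel_integrals_nonneg:
  fixes k D :: "'a \<Rightarrow> real"
  assumes D: "integrable M D" and D0: "(\<integral>y. D y \<partial>M) = 0"
    and k[measurable]: "k \<in> borel_measurable M" and kR: "AE y in M. \<bar>k y\<bar> \<le> R"
    and nonneg: "\<And>c. 0 \<le> (\<integral>y. indicator {y. k y \<le> c} y * D y \<partial>M)"
  shows "(\<integral>y. k y * D y \<partial>M) \<le> 0"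
proof -
  have [measurable]: "D \<in> borel_measurable M" using D by auto
  interpret P: pair_sigma_finite M lborel ..
  define h where "h y l = indicator {k y..R} l * D y" for y and l :: real
  have [measurable]: "case_prod h \<in> borel_measurable (M \<Otimes>\<^sub>M lborel)"
    unfolding h_def indicator_def atLeastAtMost_iff by measurable
  have inner: "(\<integral>l. h y l \<partial>lborel) = (R - k y) * D y" 
    "(\<integral>l. norm (h y l) \<partial>lborel) = (R - k y) * \<bar>D y\<bar>"
    "integrable lborel (h y)"  if "\<bar>k y\<bar> \<le> R" for y
    using that by (auto simp: h_def[abs_def] abs_mult intro!: integrable_mult_left)
  have kD: "integrable M (\<lambda>y. k y * D y)"
    by (rule Bochner_Integration.integrable_bound[of _ "\<lambda>y. R * D y"])
      (use D kR in \<open>auto simp: abs_mult elim!: eventually_mono intro!: mult_right_mono\<close>)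
  have int: "integrable (M \<Otimes>\<^sub>M lborel) (case_prod h)"
  proof (rule P.Fubini_integrable)
    have "integrable M (\<lambda>y. (R - k y) * \<bar>D y\<bar>)"
      by (rule Bochner_Integration.integrable_bound[of _ "\<lambda>y. R * D y - k y * D y"])
        (use Bochner_Integration.integrable_diff[OF integrable_mult_right[OF D, of R] kD] in
          \<open>auto simp: abs_mult simp flip: left_diff_distrib\<close>)
    then show "integrable M (\<lambda>x. \<integral>y. norm (case_prod h (x, y)) \<partial>lborel)"
      by (rule Bochner_Integration.integrable_cong_AE_imp) (use kR inner in \<open>auto elim!: eventually_mono\<close>)
    show "AE x in M. integrable lborel (\<lambda>y. case_prod h (x, y))"
      using kR by (auto elim!: eventually_mono intro: inner)
  qed simp
  have "0 \<le> (\<integral>l. (\<integral>y. h y l \<partial>M) \<partial>lborel)"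
  proof (rule Bochner_Integration.integral_nonneg)
    fix l :: real
    have "(\<integral>y. h y l \<partial>M) = indicator {..R} l * (\<integral>y. indicator {y. k y \<le> l} y * D y \<partial>M)"
      unfolding Bochner_Integration.integral_mult_right_zero[symmetric] h_def
      by (intro Bochner_Integration.integral_cong) (auto simp: indicator_def)
    then show "0 \<le> (\<integral>y. h y l \<partial>M)" using nonneg by simp
  qed
  also have "\<dots> = (\<integral>y. (\<integral>l. h y l \<partial>lborel) \<partial>M)"
    by (rule P.Fubini_integral[OF int])
  also have "\<dots> = (\<integral>y. (R - k y) * D y \<partial>M)"
    by (rule integral_cong_AE) (use kR inner in \<open>auto elim!: eventually_mono\<close>)
  also have "\<dots> = R * (\<integral>y. D y \<partial>M) - (\<integral>y. k y * D y \<partial>M)"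
    using D kD by (simp add: left_diff_distrib)
  finally show ?thesis using D0 by simp
qed

lemma (in prob_space) square_integrable_scaled_diff_diff:
  fixes f g h :: "'a \<Rightarrow> real"
  assumes [measurable]: "f \<in> borel_measurable M" "g \<in> borel_measurable M" "h \<in> borel_measurable M"
    and "integrable M (\<lambda>y. (f y)\<^sup>2)" "integrable M (\<lambda>y. (g y)\<^sup>2)" "integrable M (\<lambda>y. (h y)\<^sup>2)"
  shows "integrable M (\<lambda>y. ((f y - g y) / c - h y)\<^sup>2)"
proof (rule Bochner_Integration.integrable_bound)
  show "integrable M (\<lambda>y. 4 / c\<^sup>2 * (f y)\<^sup>2 + 4 / c\<^sup>2 * (g y)\<^sup>2 + 2 * (h y)\<^sup>2)"
    using assms by simp
  have sq: "(a - b)\<^sup>2 \<le> 2 * a\<^sup>2 + 2 * b\<^sup>2" for a b :: real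
    using zero_le_power2[of "a + b"] by (simp add: power2_eq_square algebra_simps)
  have "((f y - g y) / c - h y)\<^sup>2 \<le> 4 / c\<^sup>2 * (f y)\<^sup>2 + 4 / c\<^sup>2 * (g y)\<^sup>2 + 2 * (h y)\<^sup>2" for y
    using sq[of "(f y - g y) / c" "h y"] sq[of "f y / c" "g y / c"]
    by (simp add: diff_divide_distrib power_divide)
  then show "AE y in M. norm (((f y - g y) / c - h y)\<^sup>2)
      \<le> norm (4 / c\<^sup>2 * (f y)\<^sup>2 + 4 / c\<^sup>2 * (g y)\<^sup>2 + 2 * (h y)\<^sup>2)"
    by (auto intro: order_trans[OF _ abs_ge_self])
qed measurable

lemma abs_continuous_imp_borel_measurable:
  assumes "abs_continuous v"
  shows "v \<in> borel_measurable borel"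
proof (rule borel_measurable_continuous_onI)
  show "continuous_on UNIV v"
    unfolding continuous_on_iff
  proof (intro ballI allI impI)
    fix x e :: real assume "0 < e"
    then obtain d where "d > 0" and d: "\<And>(n::nat) a b. (\<forall>i<n. a i \<le> b i) \<and>
        disjoint_family_on (\<lambda>i. {a i<..<b i}) {..<n} \<and> (\<Sum>i<n. b i - a i) < d \<Longrightarrow>
        (\<Sum>i<n. \<bar>v (b i) - v (a i)\<bar>) < e"
      using assms unfolding abs_continuous_def by meson
    have "dist (v y) (v x) < e" if "dist y x < d" for y
      using d[of 1 "\<lambda>_. min x y" "\<lambda>_. max x y"] that
      by (auto simp: disjoint_family_on_def dist_real_def min_def max_def abs_if split: if_splits)
    with \<open>d > 0\<close> show "\<exists>d>0. \<forall>x'\<in>UNIV. dist x' x < d \<longrightarrow> dist (v x') (v x) < e" by blast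
  qed
qed

text \<open>
  The \<open>L\<^sup>2\<close> distances dominate the \<open>L\<^sup>1\<close> distances, so a subsequence converges almost everywhere; the
  uniform bound then turns this into convergence in \<open>L\<^sup>2\<close> by dominated convergence.
\<close>

lemma (in prob_space) bounded_L2_Cauchy_subsequence:
  fixes F :: "nat \<Rightarrow> 'a \<Rightarrow> real"
  assumes F[measurable]: "\<And>n. F n \<in> borel_measurable M"
    and bd: "\<And>n. AE y in M. \<bar>F n y\<bar> \<le> R"
    and cauchy: "\<And>e. 0 < e \<Longrightarrow> \<exists>N. \<forall>m\<ge>N. \<forall>n\<ge>N. (\<integral>y. (F m y - F n y)\<^sup>2 \<partial>M) < e"
  obtains r Y where "strict_mono r" "Y \<in> borel_measurable M" "AE y in M. \<bar>Y y\<bar> \<le> R"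
    "(\<lambda>n. \<integral>y. (F (r n) y - Y y)\<^sup>2 \<partial>M) \<longlonglongrightarrow> 0"
proof -
  have int: "integrable M (F n)" for n
    by (rule integrable_const_bound[where B=R]) (use bd in auto)
  have sq_le: "a\<^sup>2 \<le> c\<^sup>2" if "\<bar>a\<bar> \<le> c" for a c :: real
    using power_mono[OF that, of 2] by simp
  have diff_bd: "AE y in M. (F m y - F n y)\<^sup>2 \<le> (2 * R)\<^sup>2" for m n
    using bd[of m] bd[of n] by eventually_elim (rule sq_le, linarith)
  have int2: "integrable M (\<lambda>y. (F m y - F n y)\<^sup>2)" for m n
    by (rule integrable_const_bound[where B="(2 * R)\<^sup>2"]) (use diff_bd in auto)
  have L1: "\<exists>N. \<forall>i\<ge>N. \<forall>j\<ge>N. (\<integral>y. norm (F i y - F j y) \<partial>M) < e" if "0 < e" for e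
  proof -
    obtain N where N: "\<forall>m\<ge>N. \<forall>n\<ge>N. (\<integral>y. (F m y - F n y)\<^sup>2 \<partial>M) < e\<^sup>2"
      using cauchy[of "e\<^sup>2"] \<open>0 < e\<close> by auto
    have "(\<integral>y. norm (F i y - F j y) \<partial>M) < e" if "N \<le> i" "N \<le> j" for i j
    proof -
      have "(\<integral>y. norm (F i y - F j y) \<partial>M) \<le> sqrt (\<integral>y. (F i y - F j y)\<^sup>2 \<partial>M)"
        using integral_abs_le_sqrt[of "\<lambda>y. F i y - F j y"] int2 by simp
      also have "\<dots> < sqrt (e\<^sup>2)" using N that by (intro real_sqrt_less_mono) auto
      finally show ?thesis using \<open>0 < e\<close> by simp
    qed
    then show ?thesis by blast
  qed
  obtain r where r: "strict_mono r" and C: "AE y in M. Cauchy (\<lambda>i. F (r i) y)"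
    using cauchy_L1_AE_cauchy_subseq[OF int L1] by blast
  define Y where "Y y = lim (\<lambda>i. F (r i) y)" for y
  have Ym[measurable]: "Y \<in> borel_measurable M"
    unfolding Y_def by measurable
  have conv: "AE y in M. (\<lambda>i. F (r i) y) \<longlonglongrightarrow> Y y"
    using C by eventually_elim (simp add: Y_def convergent_LIMSEQ_iff[symmetric] Cauchy_convergent_iff)
  have "AE y in M. \<forall>n. \<bar>F (r n) y\<bar> \<le> R"
    using bd by (simp add: AE_all_countable)
  then have Ybd: "AE y in M. \<bar>Y y\<bar> \<le> R"
    using conv
  proof eventually_elim
    case (elim y)
    then show ?case
      by (intro LIMSEQ_le_const2[OF tendsto_rabs]) auto
  qed
  have "(\<lambda>n. \<integral>y. (F (r n) y - Y y)\<^sup>2 \<partial>M) \<longlonglongrightarrow> (\<integral>y. 0 \<partial>M)"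
  proof (rule integral_dominated_convergence[where w="\<lambda>_. (2 * R)\<^sup>2"])
    show "AE y in M. (\<lambda>n. (F (r n) y - Y y)\<^sup>2) \<longlonglongrightarrow> 0"
      using conv by eventually_elim (auto intro!: tendsto_eq_intros)
    show "AE y in M. norm ((F (r n) y - Y y)\<^sup>2) \<le> (2 * R)\<^sup>2" for n
      using bd[of "r n"] Ybd
      by eventually_elim (unfold real_norm_def abs_power2, rule sq_le, linarith)
  qed auto
  then show thesis using that[OF r Ym Ybd] by simp
qed

section \<open>Partial moments of a bounded flow and their time derivative\<close>

locale bounded_sticky_flow = prob_space \<rho> for \<rho> :: "real measure" +
  fixes v :: "real \<Rightarrow> real" and X :: "real \<Rightarrow> real \<Rightarrow> real" and R :: real
  assumes sets_eq [measurable_cong, simp]: "sets \<rho> = sets borel"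
    and v_measurable [measurable]: "v \<in> borel_measurable borel"
    and flow: "sticky_particles_flow_map \<rho> v X"
    and bound: "\<And>t y. 0 \<le> t \<Longrightarrow> y \<in> spt \<rho> \<Longrightarrow> \<bar>X t y\<bar> \<le> R"
begin

lemma space_eq [simp]: "space \<rho> = UNIV"
  using sets_eq_imp_space_eq[OF sets_eq] by simp

lemma prob_UNIV [simp]: "prob UNIV = 1"
  using prob_space by simp

lemma measurable_borel_eq: "borel_measurable \<rho> = borel_measurable borel"
  by (rule measurable_cong_sets) simp_all

lemma AE_spt: "AE y in \<rho>. y \<in> spt \<rho>"
  by (rule AE_mem_spt) simp

lemma AE_bound: "0 \<le> t \<Longrightarrow> AE y in \<rho>. \<bar>X t y\<bar> \<le> R"
  using AE_spt by eventually_elim (rule bound)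

lemma R_nonneg: "0 \<le> R"
proof -
  have "AE y in \<rho>. 0 \<le> R" using AE_bound[OF order_refl] by eventually_elim simp
  then show ?thesis using AE_False by (cases "0 \<le> R") auto
qed

lemma X_L2: "0 \<le> t \<Longrightarrow> integrable \<rho> (\<lambda>y. (X t y)\<^sup>2)"
  and X_measurable [measurable]: "0 \<le> t \<Longrightarrow> X t \<in> borel_measurable borel"
  using flow unfolding sticky_particles_flow_map_def L2_def measurable_borel_eq by auto

lemma X_mono: "0 \<le> t \<Longrightarrow> y \<in> spt \<rho> \<Longrightarrow> z \<in> spt \<rho> \<Longrightarrow> y \<le> z \<Longrightarrow> X t y \<le> X t z"
  using flow unfolding sticky_particles_flow_map_def by (auto dest: mono_onD)

lemma X_integrable: "0 \<le> t \<Longrightarrow> integrable \<rho> (X t)"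
  by (rule square_integrable_imp_integrable[OF _ X_L2]) simp_all

lemma integrable_imp_set_integrable [intro]:
  fixes f :: "real \<Rightarrow> real"
  assumes "integrable \<rho> f" "A \<in> sets borel"
  shows "set_integrable \<rho> A f"
  unfolding set_integrable_def using assms by (intro integrable_mult_indicator) auto

definition mom :: "real set \<Rightarrow> real \<Rightarrow> real" where
  "mom A t = (\<integral>y\<in>A. X t y \<partial>\<rho>)"

lemma mom_bound:
  assumes "0 \<le> t" "A \<in> sets borel"
  shows "\<bar>mom A t\<bar> \<le> R"
proof -
  have "\<bar>mom A t\<bar> \<le> (\<integral>y. \<bar>indicator A y * X t y\<bar> \<partial>\<rho>)"
    unfolding mom_def set_lebesgue_integral_def by (simp add: integral_abs_bound)
  also have "\<dots> \<le> (\<integral>y. R \<partial>\<rho>)"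
  proof (rule integral_mono_AE)
    show "integrable \<rho> (\<lambda>y. \<bar>indicator A y * X t y\<bar>)"
      using integrable_imp_set_integrable[OF X_integrable[OF assms(1)] assms(2)]
      by (simp add: set_integrable_def)
    show "AE y in \<rho>. \<bar>indicator A y * X t y\<bar> \<le> R"
      using AE_bound[OF assms(1)] by eventually_elim (simp add: R_nonneg indicator_def)
  qed simp
  finally show ?thesis by simp
qed

text \<open>
  The constant does not depend on \<open>A\<close>: it is the Lipschitz constant of the flow in \<open>L\<^sup>2\<close>.
\<close>

lemma mom_lipschitz:
  obtains C where "0 \<le> C"
    and "\<And>A s t. A \<in> sets borel \<Longrightarrow> 0 \<le> s \<Longrightarrow> 0 \<le> t \<Longrightarrow> \<bar>mom A t - mom A s\<bar> \<le> C * \<bar>t - s\<bar>"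
proof -
  have "\<exists>C\<ge>0. \<forall>s\<ge>0. \<forall>t\<ge>0. L2_norm \<rho> (\<lambda>y. X t y - X s y) \<le> C * \<bar>t - s\<bar>"
    using flow unfolding sticky_particles_flow_map_def by (elim conjE)
  then obtain C where C: "0 \<le> C"
    "\<And>s t. 0 \<le> s \<Longrightarrow> 0 \<le> t \<Longrightarrow> L2_norm \<rho> (\<lambda>y. X t y - X s y) \<le> C * \<bar>t - s\<bar>"
    by auto
  have "\<bar>mom A t - mom A s\<bar> \<le> C * \<bar>t - s\<bar>"
    if [measurable]: "A \<in> sets borel" and st: "0 \<le> s" "0 \<le> t" for A s t
  proof -
    have m[measurable]: "X s \<in> borel_measurable borel" "X t \<in> borel_measurable borel"
      using st by simp_all
    have "mom A t - mom A s = (\<integral>y\<in>A. X t y - X s y \<partial>\<rho>)"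
      unfolding mom_def using st by (intro set_integral_diff(2)[symmetric]) (auto intro: X_integrable)
    also have "\<bar>\<dots>\<bar> \<le> L2_norm \<rho> (\<lambda>y. X t y - X s y)"
      unfolding L2_norm_def
      using square_integrable_scaled_diff_diff[of "X t" "X s" "\<lambda>_. 0" 1] st X_L2
      by (intro abs_set_integral_le_sqrt) auto
    also have "\<dots> \<le> C * \<bar>t - s\<bar>" using C(2) st by simp
    finally show ?thesis .
  qed
  with C(1) show thesis by (rule that)
qed

text \<open>
  Derivatives in \<open>L\<^sup>2\<close> enter the argument only through the moments \<open>mom A\<close>, so the
  convergence of difference quotients is recorded in this weak form.
\<close>

definition velocity :: "real \<Rightarrow> (real \<Rightarrow> real) \<Rightarrow> bool" where
  "velocity t g \<longleftrightarrow> is_cond_exp \<rho> v (X t) g \<and>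
     (\<forall>A\<in>sets borel. (mom A has_real_derivative (\<integral>y\<in>A. g y \<partial>\<rho>)) (at t))"

text \<open>
  Testing the defining property of the conditional expectation against indicators \<open>\<zeta>\<close> shows that
  \<open>g\<close> and \<open>v\<close> carry the same momentum on every union of level sets of \<open>X t\<close>.
\<close>

lemma cond_exp_factor:
  assumes "is_cond_exp \<rho> v (X t) g" "0 \<le> t"
  obtains f where "f \<in> borel_measurable borel" "AE y in \<rho>. g y = f (X t y)"
    and "g \<in> borel_measurable borel" "integrable \<rho> (\<lambda>y. (g y)\<^sup>2)"
    and "\<And>B. B \<in> sets borel \<Longrightarrow> (\<integral>y\<in>X t -` B. g y \<partial>\<rho>) = (\<integral>y\<in>X t -` B. v y \<partial>\<rho>)"
proof -
  have [measurable]: "X t \<in> borel_measurable borel" using assms(2) by simp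
  obtain f where f: "f \<in> L2 (distr \<rho> borel (X t))"
    and eq: "\<And>\<zeta>. \<zeta> \<in> L2 (distr \<rho> borel (X t)) \<Longrightarrow>
        (\<integral>y. f (X t y) * \<zeta> (X t y) \<partial>\<rho>) = (\<integral>y. v y * \<zeta> (X t y) \<partial>\<rho>)"
    and ae: "AE y in \<rho>. g y = f (X t y)"
    using assms(1) unfolding is_cond_exp_def by blast
  have fm[measurable]: "f \<in> borel_measurable borel" using f by (simp add: L2_def)
  have gm[measurable]: "g \<in> borel_measurable borel"
    using assms(1) by (simp add: is_cond_exp_def measurable_borel_eq)
  have "integrable \<rho> (\<lambda>y. (f (X t y))\<^sup>2)"
    using f by (auto simp: L2_def integrable_distr_eq)
  then have sq: "integrable \<rho> (\<lambda>y. (g y)\<^sup>2)"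
    by (rule Bochner_Integration.integrable_cong_AE_imp) (use ae in \<open>auto elim!: eventually_mono\<close>)
  have "(\<integral>y\<in>X t -` B. g y \<partial>\<rho>) = (\<integral>y\<in>X t -` B. v y \<partial>\<rho>)"
    if [measurable]: "B \<in> sets borel" for B
  proof -
    have "(indicator B :: real \<Rightarrow> real) \<in> L2 (distr \<rho> borel (X t))"
      by (auto simp: L2_def integrable_distr_eq power2_eq_square
          intro!: integrable_const_bound[where B=1] split: split_indicator)
    note * = eq[OF this]
    have "(\<integral>y\<in>X t -` B. g y \<partial>\<rho>) = (\<integral>y. f (X t y) * indicator B (X t y) \<partial>\<rho>)"
      unfolding set_lebesgue_integral_def
      by (rule integral_cong_AE) (use ae in \<open>auto elim!: eventually_mono simp: indicator_def\<close>)
    also note *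
    also have "(\<integral>y. v y * indicator B (X t y) \<partial>\<rho>) = (\<integral>y\<in>X t -` B. v y \<partial>\<rho>)"
      unfolding set_lebesgue_integral_def
      by (rule Bochner_Integration.integral_cong) (auto simp: indicator_def)
    finally show ?thesis .
  qed
  with fm ae gm sq show thesis by (rule that)
qed

lemma AE_velocity: "AE t in lborel. 0 < t \<longrightarrow> (\<exists>g. velocity t g)"
proof -
  have "AE t in lborel. t \<ge> 0 \<longrightarrow> (\<exists>g. is_cond_exp \<rho> v (X t) g \<and>
             ((\<lambda>s. L2_norm \<rho> (\<lambda>y. (X s y - X t y) / (s - t) - g y)) \<longlongrightarrow> 0) (at t within {0..}))"
    using flow unfolding sticky_particles_flow_map_def by (elim conjE)
  then show ?thesis
  proof eventually_elim
    case (elim t)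
    show ?case
    proof
      assume t: "0 < t"
      then obtain g where g: "is_cond_exp \<rho> v (X t) g"
        and lim: "((\<lambda>s. L2_norm \<rho> (\<lambda>y. (X s y - X t y) / (s - t) - g y)) \<longlongrightarrow> 0) (at t within {0..})"
        using elim by auto
      have at: "at t within {0..} = at t"
        using t by (intro at_within_interior) (auto simp: interior_Ici)
      have gm[measurable]: "g \<in> borel_measurable borel" and g2: "integrable \<rho> (\<lambda>y. (g y)\<^sup>2)"
        using cond_exp_factor[OF g] t by auto
      have gi: "integrable \<rho> g"
        by (rule square_integrable_imp_integrable[OF _ g2]) simp
      have Xt[measurable]: "X t \<in> borel_measurable borel" using t by simp
      have "(mom A has_real_derivative (\<integral>y\<in>A. g y \<partial>\<rho>)) (at t)"
        if A[measurable]: "A \<in> sets borel" for A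
      proof -
        have "\<forall>\<^sub>F s in at t. s \<noteq> t \<and> 0 < s"
          using order_tendstoD(1)[OF tendsto_ident_at t, of UNIV]
          by (auto simp: eventually_at_filter elim: eventually_mono)
        then have "\<forall>\<^sub>F s in at t. norm ((mom A s - mom A t) / (s - t) - (\<integral>y\<in>A. g y \<partial>\<rho>))
            \<le> L2_norm \<rho> (\<lambda>y. (X s y - X t y) / (s - t) - g y)"
        proof eventually_elim
          case (elim s)
          then have s: "0 \<le> s" by simp
          have Xs[measurable]: "X s \<in> borel_measurable borel" using s by simp
          have "(\<integral>y\<in>A. (X s y - X t y) / (s - t) - g y \<partial>\<rho>)
            = (mom A s - mom A t) / (s - t) - (\<integral>y\<in>A. g y \<partial>\<rho>)"
            unfolding mom_def using s t gi X_integrable A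
            by (simp add: set_integral_diff integrable_imp_set_integrable)
          moreover have "\<bar>\<integral>y\<in>A. (X s y - X t y) / (s - t) - g y \<partial>\<rho>\<bar>
            \<le> L2_norm \<rho> (\<lambda>y. (X s y - X t y) / (s - t) - g y)"
            unfolding L2_norm_def using X_L2 s t g2
            by (intro abs_set_integral_le_sqrt square_integrable_scaled_diff_diff) auto
          ultimately show ?case by simp
        qed
        then have "((\<lambda>s. (mom A s - mom A t) / (s - t) - (\<integral>y\<in>A. g y \<partial>\<rho>)) \<longlongrightarrow> 0) (at t)"
          using lim unfolding at by (rule Lim_null_comparison)
        then show ?thesis
          unfolding has_field_derivative_iff by (simp add: LIM_zero_iff)
      qed
      with g show "\<exists>g. velocity t g" unfolding velocity_def by blast
    qed
  qed
qed

lemma mom_lipschitz_on: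
  assumes "A \<in> sets borel"
  obtains C where "\<And>a b. 0 \<le> a \<Longrightarrow> C-lipschitz_on {a..b} (mom A)"
proof -
  obtain C where "0 \<le> C" and
    "\<And>s t. 0 \<le> s \<Longrightarrow> 0 \<le> t \<Longrightarrow> \<bar>mom A t - mom A s\<bar> \<le> C * \<bar>t - s\<bar>"
    using mom_lipschitz assms by metis
  then have "C-lipschitz_on {a..b} (mom A)" if "0 \<le> a" for a b
    using that by (intro lipschitz_onI) (auto simp: dist_real_def)
  then show thesis by (rule that)
qed

lemma AE_flow_factor:
  assumes "0 < s" "s \<le> t"
  obtains f where "f \<in> borel_measurable borel" "AE y in \<rho>. X t y = f (X s y)"
proof -
  have "\<forall>s t. 0 < s \<and> s \<le> t \<longrightarrow>
      (\<exists>f C. C-lipschitz_on UNIV f \<and> (AE y in \<rho>. X t y = f (X s y)))"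
    using flow unfolding sticky_particles_flow_map_def by (elim conjE)
  then obtain f C where "C-lipschitz_on UNIV f" "AE y in \<rho>. X t y = f (X s y)"
    using assms by blast
  then show thesis
    by (intro that[of f] borel_measurable_continuous_onI lipschitz_on_continuous_on)
qed

lemma set_integral_cong_AE_set:
  fixes h :: "real \<Rightarrow> real"
  assumes "h \<in> borel_measurable borel" "A \<in> sets borel" "B \<in> sets borel"
    and "AE y in \<rho>. y \<in> A \<longleftrightarrow> y \<in> B"
  shows "(\<integral>y\<in>A. h y \<partial>\<rho>) = (\<integral>y\<in>B. h y \<partial>\<rho>)"
  using assms by (intro set_integral_cong_set) (auto simp: set_borel_measurable_def)

lemma vimage_X_measurable [measurable]:
  "0 \<le> t \<Longrightarrow> B \<in> sets borel \<Longrightarrow> X t -` B \<in> sets borel"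
  using measurable_sets[of "X t" borel borel B] by simp

text \<open>
  Particles that are together at time \<open>s > 0\<close> are together at time \<open>t \<ge> s\<close>. Hence \<open>X t -` B\<close> is, up to
  a null set, the preimage of a Borel set under \<open>X s\<close> for each such \<open>s\<close>, and its momentum at all these times is
  that of \<open>v\<close>.
\<close>

lemma mom_vimage_affine:
  assumes t: "0 < t" and B[measurable]: "B \<in> sets borel"
  shows "mom (X t -` B) t = mom (X t -` B) 0 + t * (\<integral>y\<in>X t -` B. v y \<partial>\<rho>)"
proof -
  define A where "A = X t -` B"
  have A[measurable]: "A \<in> sets borel" unfolding A_def using t by (intro vimage_X_measurable) auto
  obtain C where C: "\<And>a b. 0 \<le> a \<Longrightarrow> C-lipschitz_on {a..b} (mom A)"
    using mom_lipschitz_on A by blast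
  have "AE s in lborel. s \<in> {0<..<t} \<longrightarrow> (mom A has_real_derivative (\<integral>y\<in>A. v y \<partial>\<rho>)) (at s)"
    using AE_velocity
  proof eventually_elim
    case (elim s)
    show ?case
    proof
      assume s: "s \<in> {0<..<t}"
      then obtain g where g: "velocity s g" using elim by auto
      obtain f where f[measurable]: "f \<in> borel_measurable borel" and fX: "AE y in \<rho>. X t y = f (X s y)"
        using AE_flow_factor[of s t] s by auto
      have Xs[measurable]: "X s \<in> borel_measurable borel" using s by simp
      have fB[measurable]: "f -` B \<in> sets borel"
        using measurable_sets[OF f B] by simp
      have eq: "AE y in \<rho>. y \<in> A \<longleftrightarrow> y \<in> X s -` (f -` B)"
        using fX by eventually_elim (simp add: A_def)
      have ms: "X s -` (f -` B) \<in> sets borel" using s by (intro vimage_X_measurable) auto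
      have ce: "is_cond_exp \<rho> v (X s) g" "0 \<le> s" using g s by (auto simp: velocity_def)
      have gm: "g \<in> borel_measurable borel"
        and gv: "(\<integral>y\<in>X s -` (f -` B). g y \<partial>\<rho>) = (\<integral>y\<in>X s -` (f -` B). v y \<partial>\<rho>)"
        using cond_exp_factor[OF ce] fB by blast+
      have eq: "(\<integral>y\<in>A. g y \<partial>\<rho>) = (\<integral>y\<in>A. v y \<partial>\<rho>)"
        using set_integral_cong_AE_set[OF gm A ms eq] gv
          set_integral_cong_AE_set[OF v_measurable A ms eq] by simp
      have "(mom A has_real_derivative (\<integral>y\<in>A. g y \<partial>\<rho>)) (at s)"
        using g A unfolding velocity_def by blast
      then show "(mom A has_real_derivative (\<integral>y\<in>A. v y \<partial>\<rho>)) (at s)"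
        unfolding eq .
    qed
  qed
  from lipschitz_AE_deriv_const_imp_affine[OF less_imp_le[OF t] C this] show ?thesis
    unfolding A_def by (simp add: mult.commute)
qed

section \<open>Monotonicity of the lower moments\<close>

text \<open>
  Initial segments are taken relative to the support, where alone the maps \<open>X t\<close> are monotone; this makes
  every sublevel set of \<open>X t\<close> one of them.
\<close>

definition lower :: "real set \<Rightarrow> bool" where
  "lower L \<longleftrightarrow> L \<in> sets borel \<and> (\<forall>y\<in>L \<inter> spt \<rho>. \<forall>z\<in>spt \<rho>. z \<le> y \<longrightarrow> z \<in> L)"

lemma lower_sublevel:
  assumes "0 \<le> t"
  shows "lower (X t -` {..<c})" "lower (X t -` {..c})"
  unfolding lower_def using assms X_mono by (force intro!: vimage_X_measurable)+

text \<open>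
  If \<open>L\<close> meets the support, \<open>c\<close> is the supremum of \<open>X t\<close> over the points of \<open>L\<close> there, that is,
  the position at time \<open>t\<close> of the right end of \<open>L\<close>.
  Within the support, every level set of \<open>X t\<close> other than that of \<open>c\<close> lies inside \<open>L\<close> or outside \<open>L\<close>.
\<close>

lemma lower_cut:
  assumes "lower L" "0 \<le> t"
  obtains c where "\<And>y. y \<in> spt \<rho> \<Longrightarrow> X t y < c \<Longrightarrow> y \<in> L" "\<And>y. y \<in> spt \<rho> \<Longrightarrow> y \<in> L \<Longrightarrow> X t y \<le> c"
proof (cases "L \<inter> spt \<rho> = {}")
  case True
  have "- R \<le> X t y" if "y \<in> spt \<rho>" for y using bound[OF assms(2) that] by simp
  \<comment> \<open>No value lies below \<open>- R\<close>, so this choice makes the first condition vacuous.\<close>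
  with True show thesis by (intro that[of "- R"]) force+
next
  case False
  have bdd: "bdd_above (X t ` (L \<inter> spt \<rho>))"
    using bound[OF assms(2)] by (intro bdd_aboveI2[of _ _ R]) (auto simp: abs_le_iff)
  show thesis
  proof (rule that[of "SUP y\<in>L \<inter> spt \<rho>. X t y"])
    fix y assume y: "y \<in> spt \<rho>" "X t y < (SUP y\<in>L \<inter> spt \<rho>. X t y)"
    then obtain z where z: "z \<in> L \<inter> spt \<rho>" "X t y < X t z"
      using less_cSUP_iff[OF False bdd] by blast
    then have "y \<le> z" using X_mono[OF assms(2), of z y] y(1) by force
    then show "y \<in> L" using assms(1) z(1) y(1) unfolding lower_def by blast
  qed (auto intro: cSUP_upper[OF _ bdd])
qed

text \<open>
  The left part of a group has its centre of mass to the left of that of the whole group. If some point of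
  the left part exceeds the average \<open>\<beta>\<close>, then by monotonicity the whole right part does too; its total excess
  over \<open>\<beta>\<close> is then nonnegative, and that of the left part is the opposite.
\<close>

lemma left_part_below_average:
  fixes \<beta> :: real
  assumes L: "lower L" and P: "P \<in> sets borel" and avg: "(\<integral>y\<in>P. X 0 y - \<beta> \<partial>\<rho>) = 0"
  shows "(\<integral>y\<in>L \<inter> P. X 0 y - \<beta> \<partial>\<rho>) \<le> 0"
proof (cases "\<forall>y\<in>L \<inter> P \<inter> spt \<rho>. X 0 y \<le> \<beta>")
  case True
  have "AE y in \<rho>. 0 \<le> indicator (L \<inter> P) y * (\<beta> - X 0 y)"
    using AE_spt by eventually_elim (use True in \<open>auto simp: indicator_def\<close>)
  then have "0 \<le> (\<integral>y\<in>L \<inter> P. \<beta> - X 0 y \<partial>\<rho>)"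
    unfolding set_lebesgue_integral_def by (intro integral_nonneg_AE) simp
  also have "\<dots> = - (\<integral>y\<in>L \<inter> P. X 0 y - \<beta> \<partial>\<rho>)"
    unfolding set_lebesgue_integral_def by (simp flip: Bochner_Integration.integral_minus add: algebra_simps)
  finally show ?thesis by simp
next
  case False
  then obtain y0 where y0: "y0 \<in> L" "y0 \<in> spt \<rho>" "\<beta> < X 0 y0" by force
  have Lm: "L \<in> sets borel" using L by (simp add: lower_def)
  have int: "integrable \<rho> (\<lambda>y. X 0 y - \<beta>)" by (simp add: X_integrable)
  have "AE y in \<rho>. 0 \<le> indicator (P - L) y * (X 0 y - \<beta>)"
    using AE_spt
  proof eventually_elim
    case (elim y)
    have "X 0 y0 \<le> X 0 y" if "y \<notin> L"
      using L y0 elim that X_mono[of 0 y0 y] unfolding lower_def by (meson IntI le_cases order_refl)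
    with y0(3) show ?case by (auto simp: indicator_def)
  qed
  then have "0 \<le> (\<integral>y\<in>P - L. X 0 y - \<beta> \<partial>\<rho>)"
    unfolding set_lebesgue_integral_def by (intro integral_nonneg_AE) simp
  moreover have "(\<integral>y\<in>(L \<inter> P) \<union> (P - L). X 0 y - \<beta> \<partial>\<rho>)
      = (\<integral>y\<in>L \<inter> P. X 0 y - \<beta> \<partial>\<rho>) + (\<integral>y\<in>P - L. X 0 y - \<beta> \<partial>\<rho>)"
    using int P Lm by (intro set_integral_Un) auto
  moreover have "(L \<inter> P) \<union> (P - L) = P" by auto
  ultimately show ?thesis using avg by simp
qed

lemma set_integral_lower_split:
  fixes h :: "real \<Rightarrow> real"
  assumes h: "integrable \<rho> h" and L: "lower L" and t: "0 \<le> t"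
    and c: "\<And>y. y \<in> spt \<rho> \<Longrightarrow> X t y < c \<Longrightarrow> y \<in> L" "\<And>y. y \<in> spt \<rho> \<Longrightarrow> y \<in> L \<Longrightarrow> X t y \<le> c"
  shows "(\<integral>y\<in>L. h y \<partial>\<rho>) = (\<integral>y\<in>X t -` {..<c}. h y \<partial>\<rho>) + (\<integral>y\<in>L \<inter> X t -` {c}. h y \<partial>\<rho>)"
proof -
  have m: "L \<in> sets borel" "X t -` {..<c} \<in> sets borel" "X t -` {c} \<in> sets borel"
    using L t by (auto simp: lower_def intro: vimage_X_measurable)
  have "AE y in \<rho>. y \<in> L \<longleftrightarrow> y \<in> X t -` {..<c} \<union> (L \<inter> X t -` {c})"
    using AE_spt by eventually_elim (use c in \<open>force simp: order_le_less\<close>)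
  then have "(\<integral>y\<in>L. h y \<partial>\<rho>) = (\<integral>y\<in>X t -` {..<c} \<union> (L \<inter> X t -` {c}). h y \<partial>\<rho>)"
    using h m by (intro set_integral_cong_AE_set) (auto simp flip: measurable_borel_eq)
  also have "\<dots> = (\<integral>y\<in>X t -` {..<c}. h y \<partial>\<rho>) + (\<integral>y\<in>L \<inter> X t -` {c}. h y \<partial>\<rho>)"
    using h m by (intro set_integral_Un) auto
  finally show ?thesis .
qed

lemma set_integral_level:
  fixes g f :: "real \<Rightarrow> real"
  assumes gf: "AE y in \<rho>. g y = f (X t y)" and [measurable]: "g \<in> borel_measurable borel"
    and [measurable]: "P \<in> sets borel" and P: "P \<subseteq> X t -` {c}"
  shows "(\<integral>y\<in>P. g y \<partial>\<rho>) = f c * prob P"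
proof -
  have "(\<integral>y\<in>P. g y \<partial>\<rho>) = (\<integral>y\<in>P. f c \<partial>\<rho>)"
    unfolding set_lebesgue_integral_def
    by (rule integral_cong_AE) (use gf P in \<open>auto elim!: eventually_mono split: split_indicator\<close>)
  then show ?thesis by (simp add: set_integral_const)
qed

text \<open>
  The constant \<open>w\<close> is the common velocity of the particles that are at \<open>c\<close> at time \<open>t\<close>.
\<close>

lemma velocity_cases:
  assumes g: "velocity t g" and t: "0 < t" and L: "lower L"
  obtains c w where "\<And>y. y \<in> spt \<rho> \<Longrightarrow> X t y < c \<Longrightarrow> y \<in> L" "\<And>y. y \<in> spt \<rho> \<Longrightarrow> y \<in> L \<Longrightarrow> X t y \<le> c"
    and "integrable \<rho> g" "\<And>B. B \<in> sets borel \<Longrightarrow> (\<integral>y\<in>X t -` B. g y \<partial>\<rho>) = (\<integral>y\<in>X t -` B. v y \<partial>\<rho>)"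
    and "\<And>P. P \<in> sets borel \<Longrightarrow> P \<subseteq> X t -` {c} \<Longrightarrow> (\<integral>y\<in>P. g y \<partial>\<rho>) = w * prob P"
    and "\<And>P. P \<in> sets borel \<Longrightarrow> P \<subseteq> X t -` {c} \<Longrightarrow> mom P t = c * prob P"
proof -
  obtain c where c: "\<And>y. y \<in> spt \<rho> \<Longrightarrow> X t y < c \<Longrightarrow> y \<in> L" "\<And>y. y \<in> spt \<rho> \<Longrightarrow> y \<in> L \<Longrightarrow> X t y \<le> c"
    by (rule lower_cut[OF L less_imp_le[OF t]], rule that)
  have t': "0 \<le> t" using t by simp
  have ce: "is_cond_exp \<rho> v (X t) g" using g by (simp add: velocity_def)
  obtain f where f: "AE y in \<rho>. g y = f (X t y)" and gm: "g \<in> borel_measurable borel"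
    and g2: "integrable \<rho> (\<lambda>y. (g y)\<^sup>2)"
    and gv: "\<And>B. B \<in> sets borel \<Longrightarrow> (\<integral>y\<in>X t -` B. g y \<partial>\<rho>) = (\<integral>y\<in>X t -` B. v y \<partial>\<rho>)"
    by (rule cond_exp_factor[OF ce t'], rule that)
  have gi: "integrable \<rho> g"
    by (rule square_integrable_imp_integrable[OF _ g2]) (use gm in simp)
  show thesis
  proof (rule that[OF c gi gv])
    fix P assume P: "P \<in> sets borel" "P \<subseteq> X t -` {c}"
    show "(\<integral>y\<in>P. g y \<partial>\<rho>) = f c * prob P"
      by (rule set_integral_level[OF f gm P])
    show "mom P t = c * prob P"
      unfolding mom_def using t'
      by (intro set_integral_level[where f="\<lambda>x. x" and t=t] P) auto
  qed
qed

text \<open>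
  Both sides agree for the union \<open>A\<close> of the level sets below \<open>c\<close>. For the group \<open>P\<close> at \<open>c\<close>, the
  affine law says that its centre of mass moved from \<open>c - t * w\<close> to \<open>c\<close> in time \<open>t\<close>. The centre of mass of the
  piece \<open>L \<inter> P\<close> started no further right than \<open>c - t * w\<close> and also reached \<open>c\<close>, so its mean displacement is at least
  \<open>t * w\<close>.
\<close>

lemma velocity_le_chord:
  assumes g: "velocity t g" and t: "0 < t" and L: "lower L"
  shows "t * (\<integral>y\<in>L. g y \<partial>\<rho>) \<le> mom L t - mom L 0"
proof -
  obtain c w where c:
      "\<And>y. y \<in> spt \<rho> \<Longrightarrow> X t y < c \<Longrightarrow> y \<in> L" "\<And>y. y \<in> spt \<rho> \<Longrightarrow> y \<in> L \<Longrightarrow> X t y \<le> c"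
    and gi: "integrable \<rho> g"
    and gv: "\<And>B. B \<in> sets borel \<Longrightarrow> (\<integral>y\<in>X t -` B. g y \<partial>\<rho>) = (\<integral>y\<in>X t -` B. v y \<partial>\<rho>)"
    and gw: "\<And>P. P \<in> sets borel \<Longrightarrow> P \<subseteq> X t -` {c} \<Longrightarrow> (\<integral>y\<in>P. g y \<partial>\<rho>) = w * prob P"
    and Xc: "\<And>P. P \<in> sets borel \<Longrightarrow> P \<subseteq> X t -` {c} \<Longrightarrow> mom P t = c * prob P"
    by (rule velocity_cases[OF g t L], rule that)
  have t': "0 \<le> t" using t by simp
  define A P where "A = X t -` {..<c}" and "P = X t -` {c}"
  have m: "L \<in> sets borel" "A \<in> sets borel" "P \<in> sets borel" "L \<inter> P \<in> sets borel"
    using L t' by (auto simp: lower_def A_def P_def intro: vimage_X_measurable)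
  define \<beta> where "\<beta> = c - t * w"
  have shift: "(\<integral>y\<in>Q. X 0 y - \<beta> \<partial>\<rho>) = mom Q 0 - \<beta> * prob Q" if "Q \<in> sets borel" for Q
    unfolding mom_def using that X_integrable
    by (subst set_integral_diff) (auto simp: set_integral_const)
  have "mom P t = mom P 0 + t * (w * prob P)"
    using mom_vimage_affine[OF t, of "{c}"] gv[of "{c}"] gw[of P] m by (simp add: P_def)
  then have "(\<integral>y\<in>P. X 0 y - \<beta> \<partial>\<rho>) = 0"
    using shift[of P] Xc[of P] m by (simp add: P_def \<beta>_def algebra_simps)
  from left_part_below_average[OF L m(3) this]
  have J: "mom (L \<inter> P) 0 \<le> \<beta> * prob (L \<inter> P)"
    using shift[OF m(4)] by simp
  have A: "mom A t = mom A 0 + t * (\<integral>y\<in>A. g y \<partial>\<rho>)"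
    using mom_vimage_affine[OF t, of "{..<c}"] gv[of "{..<c}"] by (simp add: A_def)
  note split = set_integral_lower_split[OF _ L t' c, folded A_def P_def]
  have gL: "(\<integral>y\<in>L. g y \<partial>\<rho>) = (\<integral>y\<in>A. g y \<partial>\<rho>) + w * prob (L \<inter> P)"
    using split[OF gi] gw[of "L \<inter> P"] m by (simp add: P_def)
  have Lt: "mom L t = mom A t + c * prob (L \<inter> P)"
    using split[OF X_integrable[OF t']] Xc[of "L \<inter> P"] m by (simp add: P_def mom_def)
  have L0: "mom L 0 = mom A 0 + mom (L \<inter> P) 0"
    using split[OF X_integrable[of 0]] by (simp add: mom_def)
  show ?thesis
    using J unfolding gL Lt L0 A \<beta>_def by (simp add: algebra_simps)
qed

text \<open>
  The chord inequality says that \<open>(mom L t - mom L 0) / t\<close> has nonpositive derivative almost everywhere. Its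
  numerator is bounded, so the quotient tends to \<open>0\<close>, and a nonincreasing function lies above its limit.
\<close>

lemma mom_lower_ge_initial:
  assumes t: "0 < t" and L: "lower L"
  shows "mom L 0 \<le> mom L t"
proof -
  have Lm: "L \<in> sets borel" using L by (simp add: lower_def)
  define h where "h s = mom L s - mom L 0" for s
  obtain C where "0 \<le> C" and
    mC: "\<And>s t. 0 \<le> s \<Longrightarrow> 0 \<le> t \<Longrightarrow> \<bar>mom L t - mom L s\<bar> \<le> C * \<bar>t - s\<bar>"
    using mom_lipschitz Lm by metis
  have hC: "\<bar>h s - h r\<bar> \<le> C * \<bar>s - r\<bar>" "\<bar>h s\<bar> \<le> C * s" if "0 \<le> s" "0 \<le> r" for s r
    using mC[of r s] mC[of 0 s] that by (auto simp: h_def)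
  have decr: "h T / T \<le> h t / t" if T: "t \<le> T" for T
  proof (rule lipschitz_AE_deriv_nonpos_imp_le[OF T])
    have "\<bar>h x / x - h y / y\<bar> \<le> 2 * C / t * \<bar>x - y\<bar>" if xy: "t \<le> x" "t \<le> y" for x y
    proof -
      have pos: "0 < x" "0 < y" using xy t by auto
      \<comment> \<open>The quotient is Lipschitz away from time \<open>0\<close>, because \<open>h\<close> is Lipschitz and vanishes there.\<close>
      have "h x / x - h y / y = (h x - h y) / x + h y / y * ((y - x) / x)"
        using pos by (simp add: field_simps)
      also have "\<bar>\<dots>\<bar> \<le> C * \<bar>x - y\<bar> / x + C * (\<bar>x - y\<bar> / x)"
      proof (rule order_trans[OF abs_triangle_ineq add_mono])
        show "\<bar>(h x - h y) / x\<bar> \<le> C * \<bar>x - y\<bar> / x"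
          using hC(1)[of x y] pos by (simp add: abs_divide divide_right_mono)
        have "\<bar>h y / y\<bar> \<le> C"
          using hC(2)[of y 0] pos by (simp add: abs_divide divide_le_eq)
        then show "\<bar>h y / y * ((y - x) / x)\<bar> \<le> C * (\<bar>x - y\<bar> / x)"
          using pos \<open>0 \<le> C\<close> by (simp only: abs_mult) (intro mult_mono, auto simp: abs_divide abs_minus_commute)
      qed
      also have "\<dots> = 2 * C * \<bar>x - y\<bar> / x" by simp
      also have "\<dots> \<le> 2 * C * \<bar>x - y\<bar> / t"
        using xy t \<open>0 \<le> C\<close> by (intro divide_left_mono) auto
      finally show ?thesis by simp
    qed
    then show "(2 * C / t)-lipschitz_on {t..T} (\<lambda>s. h s / s)"
      using t \<open>0 \<le> C\<close> by (intro lipschitz_onI) (auto simp: dist_real_def)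
    show "AE s in lborel. s \<in> {t<..<T} \<longrightarrow> (\<exists>D\<le>0. ((\<lambda>s. h s / s) has_real_derivative D) (at s))"
      using AE_velocity
    proof eventually_elim
      case (elim s)
      show ?case
      proof
        assume s: "s \<in> {t<..<T}"
        then have s0: "0 < s" using t by auto
        with elim obtain g where g: "velocity s g" by auto
        define G where "G = (\<integral>y\<in>L. g y \<partial>\<rho>)"
        have d: "(mom L has_real_derivative G) (at s)"
          using g Lm unfolding velocity_def G_def by blast
        have "((\<lambda>s. h s / s) has_real_derivative (G * s - h s) / s\<^sup>2) (at s)"
          unfolding h_def using d s0
          by (auto intro!: derivative_eq_intros simp: power2_eq_square)
        moreover have "(G * s - h s) / s\<^sup>2 \<le> 0"
          using velocity_le_chord[OF g s0 L] unfolding G_def h_def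
          by (intro divide_nonpos_nonneg) (auto simp: mult.commute)
        ultimately show "\<exists>D\<le>0. ((\<lambda>s. h s / s) has_real_derivative D) (at s)" by blast
      qed
    qed
  qed
  have "((\<lambda>T. - 2 * R / T) \<longlongrightarrow> 0) at_top"
    by (intro tendsto_divide_0[OF tendsto_const] filterlim_at_top_imp_at_infinity filterlim_ident)
  moreover have "\<forall>\<^sub>F T in at_top. - 2 * R / T \<le> h t / t"
    using eventually_ge_at_top[of t]
  proof eventually_elim
    case (elim T)
    have "- 2 * R \<le> h T"
      unfolding h_def using mom_bound[of T L] mom_bound[of 0 L] elim t Lm by (auto simp: abs_le_iff)
    then have "- 2 * R / T \<le> h T / T" using elim t by (intro divide_right_mono) auto
    with decr[OF elim] show ?case by simp
  qed
  ultimately have "0 \<le> h t / t"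
    by (intro tendsto_upperbound[of _ 0 at_top]) auto
  then show ?thesis using t by (simp add: h_def zero_le_divide_iff)
qed

text \<open>
  The sets \<open>X t < c\<close> and \<open>X t \<le> c\<close> are unions of level sets, so their moments are affine up to time \<open>t\<close> and, by
  \<open>mom_lower_ge_initial\<close>, did not decrease; their momenta are therefore nonnegative. The momentum of \<open>L\<close>
  interpolates between these two, since the velocity is constant on the level set of \<open>c\<close>.
\<close>

lemma velocity_lower_nonneg:
  assumes g: "velocity t g" and t: "0 < t" and L: "lower L"
  shows "0 \<le> (\<integral>y\<in>L. g y \<partial>\<rho>)"
proof -
  obtain c w where c:
      "\<And>y. y \<in> spt \<rho> \<Longrightarrow> X t y < c \<Longrightarrow> y \<in> L" "\<And>y. y \<in> spt \<rho> \<Longrightarrow> y \<in> L \<Longrightarrow> X t y \<le> c"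
    and gi: "integrable \<rho> g"
    and gv: "\<And>B. B \<in> sets borel \<Longrightarrow> (\<integral>y\<in>X t -` B. g y \<partial>\<rho>) = (\<integral>y\<in>X t -` B. v y \<partial>\<rho>)"
    and gw: "\<And>P. P \<in> sets borel \<Longrightarrow> P \<subseteq> X t -` {c} \<Longrightarrow> (\<integral>y\<in>P. g y \<partial>\<rho>) = w * prob P"
    and "\<And>P. P \<in> sets borel \<Longrightarrow> P \<subseteq> X t -` {c} \<Longrightarrow> mom P t = c * prob P"
    by (rule velocity_cases[OF g t L], rule that)
  have t': "0 \<le> t" using t by simp
  define A P where "A = X t -` {..<c}" and "P = X t -` {c}"
  have m: "L \<in> sets borel" "A \<in> sets borel" "P \<in> sets borel" "L \<inter> P \<in> sets borel"
    using L t' by (auto simp: lower_def A_def P_def intro: vimage_X_measurable)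
  have nonneg: "0 \<le> (\<integral>y\<in>X t -` B. g y \<partial>\<rho>)" if "lower (X t -` B)" "B \<in> sets borel" for B
    using mom_lower_ge_initial[OF t that(1)] mom_vimage_affine[OF t that(2)] gv[OF that(2)] t
    by (simp add: zero_le_mult_iff)
  have gA: "0 \<le> (\<integral>y\<in>A. g y \<partial>\<rho>)"
    using nonneg[OF lower_sublevel(1)[OF t', of c]] by (simp add: A_def)
  have "X t -` {..c} = A \<union> P" by (auto simp: A_def P_def)
  then have "(\<integral>y\<in>X t -` {..c}. g y \<partial>\<rho>) = (\<integral>y\<in>A. g y \<partial>\<rho>) + (\<integral>y\<in>P. g y \<partial>\<rho>)"
    using gi m by (simp, intro set_integral_Un) (auto simp: A_def P_def)
  then have gAP: "0 \<le> (\<integral>y\<in>A. g y \<partial>\<rho>) + w * prob P"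
    using nonneg[OF lower_sublevel(2)[OF t', of c]] gw[of P] m by (simp add: P_def)
  have gL: "(\<integral>y\<in>L. g y \<partial>\<rho>) = (\<integral>y\<in>A. g y \<partial>\<rho>) + w * prob (L \<inter> P)"
    using set_integral_lower_split[OF gi L t' c] gw[of "L \<inter> P"] m by (simp add: P_def A_def)
  show ?thesis
  proof (cases "0 \<le> w")
    case True then show ?thesis using gA unfolding gL by simp
  next
    case False
    have "prob (L \<inter> P) \<le> prob P" using m by (intro finite_measure_mono) auto
    then have "w * prob P \<le> w * prob (L \<inter> P)" using False by (intro mult_left_mono_neg) auto
    then show ?thesis using gAP unfolding gL by simp
  qed
qed

lemma mom_lower_mono:
  assumes "0 \<le> s" "s \<le> t" and L: "lower L"
  shows "mom L s \<le> mom L t"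
proof -
  have Lm: "L \<in> sets borel" using L by (simp add: lower_def)
  obtain C where C: "\<And>a b. 0 \<le> a \<Longrightarrow> C-lipschitz_on {a..b} (mom L)"
    using mom_lipschitz_on Lm by blast
  have "AE r in lborel. r \<in> {s<..<t} \<longrightarrow> (\<exists>D\<ge>0. (mom L has_real_derivative D) (at r))"
    using AE_velocity
  proof eventually_elim
    case (elim r)
    show ?case
    proof
      assume "r \<in> {s<..<t}"
      then have r: "0 < r" using assms(1) by auto
      with elim obtain g where g: "velocity r g" by blast
      then have "(mom L has_real_derivative (\<integral>y\<in>L. g y \<partial>\<rho>)) (at r)"
        using Lm unfolding velocity_def by blast
      with velocity_lower_nonneg[OF g r L]
      show "\<exists>D\<ge>0. (mom L has_real_derivative D) (at r)" by blast
    qed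
  qed
  from lipschitz_AE_deriv_nonneg_imp_le[OF assms(2) C[OF assms(1)] this] show ?thesis .
qed

text \<open>
  The total momentum is conserved, and a nonzero value would carry the centre of mass out of \<open>[-R, R]\<close>.
\<close>

lemma mom_UNIV_const:
  assumes "0 \<le> t"
  shows "mom UNIV t = mom UNIV 0"
proof -
  define V where "V = (\<integral>y\<in>UNIV. v y \<partial>\<rho>)"
  have aff: "mom UNIV s = mom UNIV 0 + s * V" if "0 < s" for s
    using mom_vimage_affine[OF that, of UNIV] by (simp add: V_def)
  have "V = 0"
  proof (rule ccontr)
    assume V: "V \<noteq> 0"
    define s where "s = (2 * R + 1) / \<bar>V\<bar>"
    have s: "0 < s" using V R_nonneg by (simp add: s_def)
    have "\<bar>s * V\<bar> = 2 * R + 1" using V R_nonneg by (simp add: s_def abs_mult)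
    moreover have "\<bar>s * V\<bar> \<le> 2 * R"
      using aff[OF s] mom_bound[of s UNIV] mom_bound[of 0 UNIV] s by auto
    ultimately show False by simp
  qed
  then show ?thesis using aff[of t] assms by (cases "t = 0") auto
qed

section \<open>Decay of the energy and convergence\<close>

lemma X_mult_integrable:
  assumes "0 \<le> s" "0 \<le> t"
  shows "integrable \<rho> (\<lambda>y. X s y * X t y)"
proof (rule integrable_const_bound[where B="R * R"])
  show "AE y in \<rho>. norm (X s y * X t y) \<le> R * R"
    using AE_bound[OF assms(1)] AE_bound[OF assms(2)]
    by eventually_elim (auto simp: abs_mult R_nonneg intro!: mult_mono)
  show "(\<lambda>y. X s y * X t y) \<in> borel_measurable \<rho>"
    using X_measurable[OF assms(1)] X_measurable[OF assms(2)] by measurable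
qed

text \<open>
  Sublevel sets of \<open>X u\<close> are initial segments, so \<open>X t - X s\<close> has nonnegative integral over them.
\<close>

lemma increment_inner_nonpos:
  assumes "0 \<le> s" "s \<le> t" "0 \<le> u"
  shows "(\<integral>y. X u y * (X t y - X s y) \<partial>\<rho>) \<le> 0"
proof (rule integral_mult_nonpos_if_sublevel_integrals_nonneg)
  have st: "0 \<le> s" "0 \<le> t" using assms by auto
  have mom_diff: "(\<integral>y\<in>A. X t y - X s y \<partial>\<rho>) = mom A t - mom A s" if "A \<in> sets borel" for A
    unfolding mom_def using st that by (intro set_integral_diff(2)) (auto intro: X_integrable)
  show "integrable \<rho> (\<lambda>y. X t y - X s y)"
    using st by (intro Bochner_Integration.integrable_diff X_integrable)
  show "(\<integral>y. X t y - X s y \<partial>\<rho>) = 0"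
    using mom_diff[of UNIV] mom_UNIV_const[OF st(1)] mom_UNIV_const[OF st(2)]
    by (simp add: set_lebesgue_integral_def)
  show "X u \<in> borel_measurable \<rho>"
    using assms(3) by (simp add: measurable_borel_eq)
  show "AE y in \<rho>. \<bar>X u y\<bar> \<le> R" by (rule AE_bound[OF assms(3)])
  fix c
  have low: "lower (X u -` {..c})" by (rule lower_sublevel(2)[OF assms(3)])
  then have "0 \<le> mom (X u -` {..c}) t - mom (X u -` {..c}) s"
    using mom_lower_mono[OF assms(1,2)] by simp
  also have "\<dots> = (\<integral>y\<in>X u -` {..c}. X t y - X s y \<partial>\<rho>)"
    using low by (intro mom_diff[symmetric]) (simp add: lower_def)
  also have "\<dots> = (\<integral>y. indicator {y. X u y \<le> c} y * (X t y - X s y) \<partial>\<rho>)"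
    unfolding set_lebesgue_integral_def by (simp add: vimage_def)
  finally show "0 \<le> (\<integral>y. indicator {y. X u y \<le> c} y * (X t y - X s y) \<partial>\<rho>)" .
qed

definition energy :: "real \<Rightarrow> real" where
  "energy t = (\<integral>y. (X t y)\<^sup>2 \<partial>\<rho>)"

text \<open>
  Expand the square and use that \<open>X t - X s\<close> has nonpositive inner product with \<open>X t\<close>.
\<close>

lemma L2_dist_le_energy_drop:
  assumes "0 \<le> s" "s \<le> t"
  shows "(\<integral>y. (X t y - X s y)\<^sup>2 \<partial>\<rho>) \<le> energy s - energy t"
proof -
  have st: "0 \<le> s" "0 \<le> t" using assms by auto
  note int = X_mult_integrable[OF st(1) st(1)] X_mult_integrable[OF st(2) st(2)]
    X_mult_integrable[OF st(2) st(1)]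
  have "(\<integral>y. X t y * (X t y - X s y) \<partial>\<rho>) = energy t - (\<integral>y. X t y * X s y \<partial>\<rho>)"
    using int by (simp add: energy_def power2_eq_square right_diff_distrib)
  with increment_inner_nonpos[OF assms st(2)]
  have le: "energy t \<le> (\<integral>y. X t y * X s y \<partial>\<rho>)" by simp
  have "(\<integral>y. (X t y - X s y)\<^sup>2 \<partial>\<rho>)
      = (\<integral>y. X t y * X t y - 2 * (X t y * X s y) + X s y * X s y \<partial>\<rho>)"
    by (intro Bochner_Integration.integral_cong) (auto simp: power2_eq_square algebra_simps)
  also have "\<dots> = energy t - 2 * (\<integral>y. X t y * X s y \<partial>\<rho>) + energy s"
    using int by (simp add: energy_def power2_eq_square)
  finally show ?thesis using le by simp
qed

text \<open>
  The integer times give a convergent sequence of energies, hence a Cauchy sequence in \<open>L\<^sup>2\<close> and a limit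
  \<open>Y\<close> along a subsequence. The energy bound controls the distance from \<open>X t\<close> to any earlier member
  of this subsequence, which extends the convergence to all times.
\<close>

lemma L2_limit_exists:
  "\<exists>Y \<in> L2 \<rho>. ((\<lambda>t. L2_norm \<rho> (\<lambda>y. X t y - Y y)) \<longlongrightarrow> 0) at_top"
proof -
  have antimono: "energy t \<le> energy s" if "0 \<le> s" "s \<le> t" for s t
  proof -
    have "0 \<le> (\<integral>y. (X t y - X s y)\<^sup>2 \<partial>\<rho>)" by simp
    also have "\<dots> \<le> energy s - energy t" by (rule L2_dist_le_energy_drop[OF that])
    finally show ?thesis by simp
  qed
  have nonneg: "0 \<le> energy t" for t by (simp add: energy_def)
  have "decseq (\<lambda>n. energy (real n))"
    by (intro decseq_SucI antimono) auto
  then obtain E where E: "(\<lambda>n. energy (real n)) \<longlonglongrightarrow> E" and E_le: "\<And>n. E \<le> energy (real n)"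
    using decseq_convergent[of "\<lambda>n. energy (real n)" 0] nonneg by metis
  have E_le': "E \<le> energy t" if "0 \<le> t" for t
    using E_le[of "nat \<lceil>t\<rceil>"] antimono[of t "real (nat \<lceil>t\<rceil>)"] that
    by (meson of_nat_ceiling order_trans)
  have dist: "(\<integral>y. (X (real m) y - X (real n) y)\<^sup>2 \<partial>\<rho>) \<le> \<bar>energy (real m) - energy (real n)\<bar>" for m n
    using L2_dist_le_energy_drop[of "real m" "real n"] L2_dist_le_energy_drop[of "real n" "real m"]
    by (cases "m \<le> n") (auto simp: power2_commute[of "X (real m) _"])
  have cauchy: "\<exists>N. \<forall>m\<ge>N. \<forall>n\<ge>N. (\<integral>y. (X (real m) y - X (real n) y)\<^sup>2 \<partial>\<rho>) < e" if "0 < e" for e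
  proof -
    have "Cauchy (\<lambda>n. energy (real n))" using E by (rule LIMSEQ_imp_Cauchy)
    then obtain N where "\<forall>m\<ge>N. \<forall>n\<ge>N. \<bar>energy (real m) - energy (real n)\<bar> < e"
      using \<open>0 < e\<close> unfolding Cauchy_def dist_real_def by blast
    then show ?thesis using dist by (meson le_less_trans)
  qed
  have Xm: "X (real n) \<in> borel_measurable \<rho>" for n by (simp add: measurable_borel_eq)
  obtain r Y where r: "strict_mono r" and Y: "Y \<in> borel_measurable \<rho>" "AE y in \<rho>. \<bar>Y y\<bar> \<le> R"
    and lim: "(\<lambda>n. \<integral>y. (X (real (r n)) y - Y y)\<^sup>2 \<partial>\<rho>) \<longlonglongrightarrow> 0"
    by (rule bounded_L2_Cauchy_subsequence[where F="\<lambda>n. X (real n)" and R=R])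
      (use Xm AE_bound cauchy in \<open>auto\<close>)
  have Y2: "integrable \<rho> (\<lambda>y. (Y y)\<^sup>2)"
  proof (rule integrable_const_bound[where B="R\<^sup>2"])
    show "AE y in \<rho>. norm ((Y y)\<^sup>2) \<le> R\<^sup>2"
      using Y(2) by eventually_elim (use power_mono[of "\<bar>_\<bar>" R 2] in auto)
  qed (use Y(1) in simp)
  define b where "b n = 2 * (energy (real (r n)) - E) + 2 * (\<integral>y. (X (real (r n)) y - Y y)\<^sup>2 \<partial>\<rho>)" for n
  have "(\<lambda>n. energy (real (r n))) \<longlonglongrightarrow> E"
    using LIMSEQ_subseq_LIMSEQ[OF E r] by (simp add: o_def)
  then have b: "b \<longlonglongrightarrow> 0"
    unfolding b_def using lim by (auto intro!: tendsto_eq_intros)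
  have le_b: "(\<integral>y. (X t y - Y y)\<^sup>2 \<partial>\<rho>) \<le> b n" if t: "real (r n) \<le> t" for t n
  proof -
    define s where "s = real (r n)"
    have st: "0 \<le> s" "s \<le> t" "0 \<le> t" using t by (auto simp: s_def)
    have ms: "X s \<in> borel_measurable \<rho>" "X t \<in> borel_measurable \<rho>"
      using st by (simp_all add: measurable_borel_eq)
    have i: "integrable \<rho> (\<lambda>y. (X t y - X s y)\<^sup>2)" "integrable \<rho> (\<lambda>y. (X s y - Y y)\<^sup>2)"
      "integrable \<rho> (\<lambda>y. (X t y - Y y)\<^sup>2)"
      using square_integrable_scaled_diff_diff[of "X t" "X s" "\<lambda>_. 0" 1] square_integrable_scaled_diff_diff[of "X s" "\<lambda>_. 0" Y 1]
        square_integrable_scaled_diff_diff[of "X t" "\<lambda>_. 0" Y 1] ms Y(1) Y2 X_L2 st by auto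
    have sq: "(p - q)\<^sup>2 \<le> 2 * (p - x)\<^sup>2 + 2 * (x - q)\<^sup>2" for p q x :: real
      using zero_le_power2[of "(p - x) - (x - q)"] by (simp add: power2_eq_square algebra_simps)
    have "(\<integral>y. (X t y - Y y)\<^sup>2 \<partial>\<rho>) \<le> (\<integral>y. 2 * (X t y - X s y)\<^sup>2 + 2 * (X s y - Y y)\<^sup>2 \<partial>\<rho>)"
      using i sq by (intro integral_mono) auto
    also have "\<dots> = 2 * (\<integral>y. (X t y - X s y)\<^sup>2 \<partial>\<rho>) + 2 * (\<integral>y. (X s y - Y y)\<^sup>2 \<partial>\<rho>)"
      using i by simp
    also have "\<dots> \<le> b n"
      using L2_dist_le_energy_drop[OF st(1,2)] E_le'[OF st(3)] unfolding b_def s_def by simp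
    finally show ?thesis .
  qed
  have "((\<lambda>t. \<integral>y. (X t y - Y y)\<^sup>2 \<partial>\<rho>) \<longlongrightarrow> 0) at_top"
  proof (rule tendstoI)
    fix e :: real assume "0 < e"
    then have "\<forall>\<^sub>F n in sequentially. b n < e" using b by (intro order_tendstoD)
    then obtain n where n: "b n < e" by (auto simp: eventually_sequentially)
    show "\<forall>\<^sub>F t in at_top. dist (\<integral>y. (X t y - Y y)\<^sup>2 \<partial>\<rho>) 0 < e"
      using eventually_ge_at_top[of "real (r n)"]
      by eventually_elim (use le_b n in \<open>auto simp: dist_real_def intro: le_less_trans\<close>)
  qed
  from tendsto_real_sqrt[OF this] show ?thesis
    using Y Y2 by (intro bexI[of _ Y]) (auto simp: L2_def L2_norm_def)
qed

end

theorem theorem5p1: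
  fixes \<rho>\<^sub>0 :: "real measure" and v\<^sub>0 :: "real \<Rightarrow> real" and X :: "real \<Rightarrow> real \<Rightarrow> real" and R :: real
  assumes "\<rho>\<^sub>0 \<in> P2"
    and "abs_continuous v\<^sub>0"
    and "sticky_particles_flow_map \<rho>\<^sub>0 v\<^sub>0 X"
    and "\<And>t y. t \<ge> 0 \<Longrightarrow> y \<in> spt \<rho>\<^sub>0 \<Longrightarrow> \<bar>X t y\<bar> \<le> R"
  shows "\<exists>Y \<in> L2 \<rho>\<^sub>0. ((\<lambda>t. L2_norm \<rho>\<^sub>0 (\<lambda>y. X t y - Y y)) \<longlongrightarrow> 0) at_top"
proof -
  interpret prob_space \<rho>\<^sub>0 using assms(1) by (simp add: P2_def)
  interpret bounded_sticky_flow \<rho>\<^sub>0 v\<^sub>0 X R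
    using assms by unfold_locales (auto simp: P2_def abs_continuous_imp_borel_measurable)
  show ?thesis by (rule L2_limit_exists)
qed

end
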